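(* Let $\Sigma_4=\{0,1,2,3\}$. There exists an infinite word over $\Sigma_4$ that is squarefree and contains no occurrence of any of the subwords $12$, $13$, $21$, $32$, $231$, $10302$.
   Context: A square is a nonempty word of the form $xx$. A (finite or infinite) word is squarefree if it contains no square as a (contiguous) subword. *)

theory Defs
  imports "HOL-Library.Omega_Words_Fun"
begin

definition square :: "'a list \<Rightarrow> bool" where
  "square u \<longleftrightarrow> (\<exists>x. x \<noteq> [] \<and> u = x @ x)"

definition subword :: "'a list \<Rightarrow> 'a word \<Rightarrow> bool" where
  "subword u w \<longleftrightarrow> (\<exists>i j. i \<le> j \<and> u = w [i \<rightarrow> j])"

definition squarefree_word :: "'a word \<Rightarrow> bool" where
  "squarefree_word w \<longleftrightarrow> \<not> (\<exists>u. square u \<and> subword u w)"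

end

theory Submission
  imports Defs
begin

text \<open>
  The word is the fixed point \<open>h\<^sup>\<omega>(0)\<close> of the 8-uniform morphism
  \<open>0 \<mapsto> 02301031\<close>, \<open>1 \<mapsto> 02302031\<close>, \<open>2 \<mapsto> 02010301\<close>, \<open>3 \<mapsto> 02030201\<close>,
  found by computer search.
  The factor \<open>102\<close> occurs in it exactly across the boundaries between consecutive images of
  letters, so a square \<open>xx\<close> with \<open>|x| \<ge> 10\<close> has \<open>|x|\<close> divisible by 8. A letter is determined by
  positions 3 and 4 of its image, and also by positions 4 and 5; hence, wherever the square
  starts, it desubstitutes to a square of period \<open>|x| / 8\<close>, and descent applies. Squares with
  \<open>|x| \<le> 9\<close> and the forbidden factors lie within the image of a factor of length 4, of which
  there are only 20.
\<close>

section \<open>The morphism and its fixed point\<close>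

definition letter_image :: "nat \<Rightarrow> nat list" where
  "letter_image a =
    [[0,2,3,0,1,0,3,1], [0,2,3,0,2,0,3,1], [0,2,0,1,0,3,0,1], [0,2,0,3,0,2,0,1]] ! a"

text \<open>Splitting off \<open>n = 0\<close> keeps the recursion terminating, as
  \<open>0 div 8 = 0\<close>. The value agrees with the morphism because the image of 0 begins with
  0.\<close>

fun fixed_word :: "nat word" where
  "fixed_word n = (if n = 0 then 0 else letter_image (fixed_word (n div 8)) ! (n mod 8))"

declare fixed_word.simps [simp del]

text \<open>This set contains the prefix \<open>[0,2,3,0]\<close> and is closed under taking
  length-4 windows that start in the first block of an image, so it covers every length-4
  factor.\<close>

definition factors4 :: "nat list list" where
  "factors4 =
    [[0,1,0,2], [0,1,0,3], [0,2,0,1], [0,2,0,3], [0,2,3,0],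
     [0,3,0,1], [0,3,0,2], [0,3,1,0], [1,0,2,0], [1,0,2,3],
     [1,0,3,0], [1,0,3,1], [2,0,1,0], [2,0,3,0], [2,0,3,1],
     [2,3,0,1], [2,3,0,2], [3,0,1,0], [3,0,2,0], [3,1,0,2]]"

lemma fixed_word_0 [simp]: "fixed_word 0 = 0"
  by (simp add: fixed_word.simps)

lemma fixed_word_rec: "fixed_word n = letter_image (fixed_word (n div 8)) ! (n mod 8)"
  by (cases "n = 0") (simp_all add: fixed_word.simps [of n] letter_image_def)

lemma fixed_word_image:
  assumes "r < 8"
  shows "fixed_word (8 * q + r) = letter_image (fixed_word q) ! r"
  using assms by (subst fixed_word_rec) simp

lemma fixed_word_less_4: "fixed_word n < 4"
proof (induction n rule: less_induct)
  case (less n)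
  \<comment> \<open>Quantifiers range over \<open>set\<close> of explicit lists so that
    \<open>code_simp\<close> can evaluate them; the later finite checks do the same.\<close>
  have fin: "\<forall>a\<in>set [0..<4]. \<forall>r\<in>set [0..<8]. letter_image a ! r < 4"
    by code_simp
  show ?case
  proof (cases "n = 0")
    case False
    then have "fixed_word (n div 8) < 4"
      by (intro less) simp
    then show ?thesis
      using fin by (subst fixed_word_rec) simp
  qed simp
qed

lemma length_letter_image:
  assumes "a < 4"
  shows "length (letter_image a) = 8"
proof -
  have "\<forall>a\<in>set [0..<4]. length (letter_image a) = 8"
    by code_simp
  with assms show ?thesis by simp
qed

section \<open>Windows of the fixed point inside images of factors\<close>

lemma subsequence_4: "w [q \<rightarrow> q + 4] = [w q, w (q + 1), w (q + 2), w (q + 3)]"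
  by (simp add: subsequence_def upt_conv_Cons eval_nat_numeral)

lemma fixed_word_segment:
  assumes "r + l \<le> 32"
  shows "fixed_word [8 * q + r \<rightarrow> 8 * q + r + l] =
    take l (drop r (concat (map letter_image (fixed_word [q \<rightarrow> q + 4]))))"
    (is "_ = take l (drop r ?H)")
proof -
  have len: "length (letter_image (fixed_word n)) = 8" for n
    by (simp add: length_letter_image fixed_word_less_4)
  have H: "?H = letter_image (fixed_word q) @ letter_image (fixed_word (q + 1)) @
      letter_image (fixed_word (q + 2)) @ letter_image (fixed_word (q + 3))"
    by (simp add: subsequence_4)
  have nth: "fixed_word (8 * q + t) = ?H ! t" if t: "t < 32" for t
  proof -
    consider "t < 8" | "8 \<le> t" "t < 16" | "16 \<le> t" "t < 24" | "24 \<le> t" "t < 32"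
      using t by atomize_elim arith
    then show ?thesis
    proof cases
      case 1
      then show ?thesis by (simp add: H nth_append len fixed_word_image)
    next
      case 2
      then show ?thesis
        using fixed_word_image [of "t - 8" "q + 1"]
        by (simp add: H nth_append len less_diff_conv2)
    next
      case 3
      then show ?thesis
        using fixed_word_image [of "t - 16" "q + 2"]
        by (simp add: H nth_append len less_diff_conv2)
    next
      case 4
      then show ?thesis
        using fixed_word_image [of "t - 24" "q + 3"]
        by (simp add: H nth_append len less_diff_conv2)
    qed
  qed
  have "length ?H = 32"
    by (simp add: H len)
  with assms show ?thesis
    by (intro nth_equalityI) (simp_all add: add.assoc nth)
qed

text \<open>The window at \<open>n\<close> lies in the image of the window at
  \<open>n div 8\<close>, which is earlier unless \<open>n = 0\<close>.\<close>

lemma fixed_word_factors4: "fixed_word [n \<rightarrow> n + 4] \<in> set factors4"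
proof (induction n rule: less_induct)
  case (less n)
  show ?case
  proof (cases "n = 0")
    case True
    have "fixed_word [0 \<rightarrow> 4] = take 4 (letter_image 0)"
      using fixed_word_image [of _ 0]
      by (intro nth_equalityI) (simp_all add: length_letter_image)
    then show ?thesis
      using True by (simp add: letter_image_def factors4_def)
  next
    case False
    have fin: "\<forall>s\<in>set factors4. \<forall>r\<in>set [0..<8].
        take 4 (drop r (concat (map letter_image s))) \<in> set factors4"
      by code_simp
    have "fixed_word [n div 8 \<rightarrow> n div 8 + 4] \<in> set factors4"
      using False by (intro less) simp
    moreover have "n mod 8 \<in> set [0..<8]"
      by simp
    ultimately have "take 4 (drop (n mod 8)
        (concat (map letter_image (fixed_word [n div 8 \<rightarrow> n div 8 + 4])))) \<in> set factors4"
      using fin by blast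
    then show ?thesis
      using fixed_word_segment [of "n mod 8" 4 "n div 8"] by simp
  qed
qed

text \<open>Reduces claims about short windows to finitely many pairs \<open>(s, r)\<close>. The
  bound 24 is safe because an offset of at most 7 leaves at least 25 of the 32 letters.\<close>

lemma fixed_word_segmentE:
  fixes n :: nat
  obtains s r where "s \<in> set factors4" "r \<in> set [0..<8]" "r = n mod 8"
    "\<forall>l\<le>24. fixed_word [n \<rightarrow> n + l] = take l (drop r (concat (map letter_image s)))"
proof (rule that)
  show "fixed_word [n div 8 \<rightarrow> n div 8 + 4] \<in> set factors4"
    by (rule fixed_word_factors4)
  show "n mod 8 \<in> set [0..<8]" "n mod 8 = n mod 8"
    by simp_all
  have "n mod 8 + l \<le> 32" if "l \<le> 24" for l
    using that mod_less_divisor [of 8 n] by linarith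
  then show "\<forall>l\<le>24. fixed_word [n \<rightarrow> n + l] = take l (drop (n mod 8)
      (concat (map letter_image (fixed_word [n div 8 \<rightarrow> n div 8 + 4]))))"
    using fixed_word_segment [of "n mod 8" _ "n div 8"] by simp
qed

text \<open>Every image ends in 1 and begins with 02, so 102 straddles each block boundary; the
  finite check excludes all other offsets.\<close>

lemma fixed_word_marker: "fixed_word [n \<rightarrow> n + 3] = [1,0,2] \<longleftrightarrow> n mod 8 = 7"
proof -
  have fin: "\<forall>s\<in>set factors4. \<forall>r\<in>set [0..<8].
      take 3 (drop r (concat (map letter_image s))) = [1,0,2] \<longleftrightarrow> r = 7"
    by code_simp
  obtain s r where "s \<in> set factors4" "r \<in> set [0..<8]" "r = n mod 8"
    "\<forall>l\<le>24. fixed_word [n \<rightarrow> n + l] = take l (drop r (concat (map letter_image s)))"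
    using fixed_word_segmentE [of n] by blast
  with fin show ?thesis by simp
qed

lemma fixed_word_avoids:
  assumes "u \<in> set [[1,2], [1,3], [2,1], [3,2], [2,3,1], [1,0,3,0,2]]"
  shows "\<not> subword u fixed_word"
proof
  have fin: "\<forall>u\<in>set [[1,2], [1,3], [2,1], [3,2], [2,3,1], [1,0,3,0,2]]. length u \<le> 24 \<and>
      (\<forall>s\<in>set factors4. \<forall>r\<in>set [0..<8].
        take (length u) (drop r (concat (map letter_image s))) \<noteq> u)"
    by code_simp
  assume "subword u fixed_word"
  then obtain i j where "i \<le> j" "u = fixed_word [i \<rightarrow> j]"
    by (auto simp: subword_def)
  then have u: "fixed_word [i \<rightarrow> i + length u] = u"
    by simp
  obtain s r where "s \<in> set factors4" "r \<in> set [0..<8]" "r = i mod 8"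
    "\<forall>l\<le>24. fixed_word [i \<rightarrow> i + l] = take l (drop r (concat (map letter_image s)))"
    using fixed_word_segmentE [of i] by blast
  with fin assms u show False by metis
qed

lemma no_short_square:
  assumes "p \<in> set [1..<10]"
  shows "fixed_word [i \<rightarrow> i + p] \<noteq> fixed_word [i + p \<rightarrow> i + p + p]"
proof
  assume eq: "fixed_word [i \<rightarrow> i + p] = fixed_word [i + p \<rightarrow> i + p + p]"
  have fin: "\<forall>p\<in>set [1..<10]. \<forall>s\<in>set factors4. \<forall>r\<in>set [0..<8].
      take p (drop r (concat (map letter_image s))) \<noteq>
      drop p (take (p + p) (drop r (concat (map letter_image s))))"
    by code_simp
  obtain s r where s: "s \<in> set factors4" "r \<in> set [0..<8]" "r = i mod 8"
    and seg: "\<forall>l\<le>24.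
      fixed_word [i \<rightarrow> i + l] = take l (drop r (concat (map letter_image s)))"
    using fixed_word_segmentE [of i] by blast
  have "fixed_word [i + p \<rightarrow> i + p + p] = drop p (fixed_word [i \<rightarrow> i + (p + p)])"
    by (simp add: subsequence_def drop_map add.assoc)
  also have "\<dots> = drop p (take (p + p) (drop r (concat (map letter_image s))))"
    using assms seg by simp
  finally show False
    using eq seg fin assms s by auto
qed

section \<open>Desubstitution and descent\<close>

text \<open>The pairs at positions 3, 4 are 01, 02, 10, 30 and those at positions 4, 5 are 10, 20,
  03, 02; each list has distinct entries.\<close>

lemma letter_determined:
  assumes "a < 4" "b < 4" "k \<in> {3, 4}"
    and "letter_image a ! k = letter_image b ! k"
    and "letter_image a ! (k + 1) = letter_image b ! (k + 1)"
  shows "a = b"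
proof -
  have "\<forall>a\<in>set [0..<4]. \<forall>b\<in>set [0..<4]. \<forall>k\<in>set [3,4].
      letter_image a ! k = letter_image b ! k \<longrightarrow>
      letter_image a ! (k + 1) = letter_image b ! (k + 1) \<longrightarrow> a = b"
    by code_simp
  with assms show ?thesis by auto
qed

text \<open>Pointwise form of a square of half-length \<open>p\<close>. The start \<open>i\<close>
  stays arbitrary because desubstitution moves it.\<close>

lemma no_repetition:
  assumes "p > 0"
  shows "\<not> (\<forall>j<p. fixed_word (i + j) = fixed_word (i + j + p))"
  using assms
proof (induction p arbitrary: i rule: less_induct)
  case (less p)
  show ?case
  proof
    assume rep: "\<forall>j<p. fixed_word (i + j) = fixed_word (i + j + p)"
    show False
    proof (cases "p < 10")
      case True
      have "fixed_word [i \<rightarrow> i + p] = fixed_word [i + p \<rightarrow> i + p + p]"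
        using rep by (intro nth_equalityI) (simp_all add: algebra_simps)
      then show False
        using no_short_square [of p i] True less.prems by simp
    next
      case False
      define q r where "q = i div 8" and "r = i mod 8"
      have i: "i = 8 * q + r" and "r < 8"
        by (simp_all add: q_def r_def)
      \<comment> \<open>Distance to the first marker at or after \<open>i\<close>. Since
        \<open>c\<close> is at most 7 and \<open>p\<close> at least 10, the whole marker lies in the
        first half and is repeated \<open>p\<close> letters later.\<close>
      define c where "c = 7 - r"
      have c: "c + 2 < p" "(i + c) mod 8 = 7"
        using False \<open>r < 8\<close> by (simp_all add: c_def i)
      have "fixed_word [i + c \<rightarrow> i + c + 3] = fixed_word [i + c + p \<rightarrow> i + c + p + 3]"
      proof (intro nth_equalityI)
        fix j assume "j < length (fixed_word [i + c \<rightarrow> i + c + 3])"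
        then show "fixed_word [i + c \<rightarrow> i + c + 3] ! j
            = fixed_word [i + c + p \<rightarrow> i + c + p + 3] ! j"
          using rep [rule_format, of "c + j"] c(1) by (simp add: algebra_simps)
      qed simp
      then have "(i + c + p) mod 8 = 7"
        using fixed_word_marker c(2) by metis
      with c(2) have "p mod 8 = 0"
        by presburger
      then obtain m where m: "p = 8 * m"
        by auto
      \<comment> \<open>The repetition in block coordinates: letter \<open>u\<close> of block
        \<open>q + s\<close> recurs \<open>m\<close> blocks later.\<close>
      have shift: "fixed_word (8 * (q + s) + u) = fixed_word (8 * (q + s + m) + u)"
        if "r \<le> 8 * s + u" "8 * s + u < r + p" for s u
        using rep [rule_format, of "8 * s + u - r"] that by (simp add: i m algebra_simps)
      have desubst: "fixed_word (q + s) = fixed_word (q + s + m)"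
        if "k \<in> {3, 4}" "r \<le> 8 * s + k" "8 * s + k + 1 < r + p" for s k
      proof (rule letter_determined [OF fixed_word_less_4 fixed_word_less_4 that(1)])
        show "letter_image (fixed_word (q + s)) ! k
            = letter_image (fixed_word (q + s + m)) ! k"
          using shift [of s k] that
            fixed_word_image [of k "q + s"] fixed_word_image [of k "q + s + m"]
          by auto
        show "letter_image (fixed_word (q + s)) ! (k + 1)
            = letter_image (fixed_word (q + s + m)) ! (k + 1)"
          using shift [of s "k + 1"] that
            fixed_word_image [of "k + 1" "q + s"] fixed_word_image [of "k + 1" "q + s + m"]
          by auto
      qed
      have "\<exists>i. \<forall>j<m. fixed_word (i + j) = fixed_word (i + j + m)"
      \<comment> \<open>If \<open>r \<le> 4\<close>, positions 4, 5 of blocks \<open>q\<close> to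
        \<open>q + m - 1\<close> lie in the first half. Otherwise \<open>r \<ge> 5\<close>, and
        positions 3, 4 of blocks \<open>q + 1\<close> to \<open>q + m\<close> do; the last of these,
        \<open>8 * m + 4\<close>, is below \<open>r + p\<close> exactly because
        \<open>r \<ge> 5\<close>.\<close>
      proof (cases "r \<le> 4")
        case True
        then have "\<forall>j<m. fixed_word (q + j) = fixed_word (q + j + m)"
          using desubst [of 4] m by simp
        then show ?thesis ..
      next
        case False
        have "fixed_word (q + 1 + j) = fixed_word (q + 1 + j + m)" if "j < m" for j
          using desubst [of 3 "j + 1"] that False m \<open>r < 8\<close> by simp
        then have "\<forall>j<m. fixed_word (q + 1 + j) = fixed_word (q + 1 + j + m)"
          by blast
        then show ?thesis ..
      qed
      moreover have "m < p" "0 < m"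
        using m less.prems by simp_all
      ultimately show False
        using less.IH by blast
    qed
  qed
qed

lemma squarefree_fixed_word: "squarefree_word fixed_word"
  unfolding squarefree_word_def
proof
  assume "\<exists>u. square u \<and> subword u fixed_word"
  then obtain x i j where x: "x \<noteq> []" "i \<le> j" "x @ x = fixed_word [i \<rightarrow> j]"
    by (auto simp: square_def subword_def)
  have len: "j - i = length x + length x"
    using arg_cong [OF x(3), of length] by simp
  have nth: "fixed_word (i + t) = (x @ x) ! t" if "t < length x + length x" for t
    using that x(3) len by simp
  have "fixed_word (i + t) = fixed_word (i + t + length x)" if "t < length x" for t
    using that nth [of t] nth [of "t + length x"] by (simp add: nth_append add.assoc)
  then show False
    using no_repetition [of "length x" i] x(1) by simp
qed

theorem theorem1:
  shows "\<exists>w :: nat word.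
           (\<forall>n. w n \<in> {0, 1, 2, 3}) \<and>
           squarefree_word w \<and>
           (\<forall>u \<in> {[1,2], [1,3], [2,1], [3,2], [2,3,1], [1,0,3,0,2]}. \<not> subword u w)"
proof (intro exI conjI allI ballI)
  show "fixed_word n \<in> {0, 1, 2, 3}" for n
    using fixed_word_less_4 [of n] by auto
  show "squarefree_word fixed_word"
    by (rule squarefree_fixed_word)
  show "\<not> subword u fixed_word"
    if "u \<in> {[1,2], [1,3], [2,1], [3,2], [2,3,1], [1,0,3,0,2]}" for u
    using that by (intro fixed_word_avoids) simp
qed

end
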